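(* If $(S,N)$ is a quadratic normalisation of class $(4,3)$, then $(S,N)$ is of $p$-class $(4,3)$ for every $p\ge3$; that is, for every $p\ge 3$ and every word $w$ over $S$ of length $p$, $N(w)=N^{[p-1]}_{1212}(w)$ and $N(w)=N^{[p-1]}_{212}(w)$.
   Context: For a set $S$, $S^*$ is the free monoid of words over $S$, $\|w\|$ is word length, $u|v$ is concatenation, $S^{[p]}$ is the set of words of length $p$. A normalisation is a pair $(S,N)$ with $N:S^*\to S^*$ such that for all words $u,v,w$: $\|N(w)\|=\|w\|$; $\|w\|=1$ implies $N(w)=w$; $N(u|N(w)|v)=N(u|w|v)$. A word is $N$-normal if $N(w)=w$. $\overline{N}$ is the restriction of $N$ to $S^{[2]}$; $\overline{N}_i$ applies $\overline{N}$ to the entries in positions $i,i+1$; $\overline{N}_{i_1\cdots i_n}=\overline{N}_{i_n}\circ\cdots\circ\overline{N}_{i_1}$. $(S,N)$ is quadratic if (a) a word is $N$-normal iff each of its length-two factors is, and (b) for every word $w$ there is a finite sequence $u$ of positions with $N(w)=\overline{N}_u(w)$. It is of class $(4,3)$ if $N(w)=\overline{N}_{1212}(w)=\overline{N}_{212}(w)$ for all $w\in S^{[3]}$. $N^{[q]}$ denotes the restriction of $N$ to $S^{[q]}$. On words of length $p$, $N^{[p-1]}_1$ applies $N^{[p-1]}$ to the factor formed by the first $p-1$ letters and $N^{[p-1]}_2$ applies it to the factor formed by the last $p-1$ letters; $N^{[p-1]}_{i_1\cdots i_n}=N^{[p-1]}_{i_n}\circ\cdots\circ N^{[p-1]}_{i_1}$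 ($i_1$ first). *)

theory Defs
  imports Main
begin

text \<open>Words over \<open>S\<close> are the elements of \<^term>\<open>lists S\<close>. Only the values of \<open>N\<close> on \<^term>\<open>lists S\<close>
  are constrained or used.\<close>

definition normalisation :: "'a set \<Rightarrow> ('a list \<Rightarrow> 'a list) \<Rightarrow> bool" where
  "normalisation S N \<longleftrightarrow>
     (\<forall>w\<in>lists S. N w \<in> lists S) \<and>
     (\<forall>w\<in>lists S. length (N w) = length w) \<and>
     (\<forall>w\<in>lists S. length w = 1 \<longrightarrow> N w = w) \<and>
     (\<forall>u\<in>lists S. \<forall>v\<in>lists S. \<forall>w\<in>lists S. N (u @ N w @ v) = N (u @ w @ v))"

definition normal_word :: "('a list \<Rightarrow> 'a list) \<Rightarrow> 'a list \<Rightarrow> bool" where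
  "normal_word N w \<longleftrightarrow> N w = w"

text \<open>\<open>apply_at N q i\<close> is $N^{[q]}_i$: it applies \<open>N\<close> to the factor of length \<open>q\<close> that starts at the
  \<open>i\<close>-th letter, letters being counted from 1. It is meant for \<open>1 \<le> i\<close> and
  \<open>i + q \<le> length w + 1\<close> only; for \<open>q = 2\<close> it is $\overline{N}_i$.\<close>

definition apply_at :: "('a list \<Rightarrow> 'a list) \<Rightarrow> nat \<Rightarrow> nat \<Rightarrow> 'a list \<Rightarrow> 'a list" where
  "apply_at N q i w =
     take (i - 1) w @ N (take q (drop (i - 1) w)) @ drop (i - 1 + q) w"

text \<open>The head of the list of positions is applied first.\<close>

definition apply_seq :: "('a list \<Rightarrow> 'a list) \<Rightarrow> nat \<Rightarrow> nat list \<Rightarrow> 'a list \<Rightarrow> 'a list" where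
  "apply_seq N q is w = fold (apply_at N q) is w"

definition quadratic :: "'a set \<Rightarrow> ('a list \<Rightarrow> 'a list) \<Rightarrow> bool" where
  "quadratic S N \<longleftrightarrow>
     (\<forall>w\<in>lists S. normal_word N w \<longleftrightarrow>
        (\<forall>u x v. w = u @ x @ v \<and> length x = 2 \<longrightarrow> normal_word N x)) \<and>
     (\<forall>w\<in>lists S. \<exists>is. (\<forall>i\<in>set is. 1 \<le> i \<and> i < length w) \<and> N w = apply_seq N 2 is w)"

definition class_4_3 :: "'a set \<Rightarrow> ('a list \<Rightarrow> 'a list) \<Rightarrow> bool" where
  "class_4_3 S N \<longleftrightarrow>
     (\<forall>w\<in>lists S. length w = 3 \<longrightarrow>
        N w = apply_seq N 2 [1, 2, 1, 2] w \<and> N w = apply_seq N 2 [2, 1, 2] w)"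

definition p_class_4_3 :: "nat \<Rightarrow> 'a set \<Rightarrow> ('a list \<Rightarrow> 'a list) \<Rightarrow> bool" where
  "p_class_4_3 p S N \<longleftrightarrow>
     (\<forall>w\<in>lists S. length w = p \<longrightarrow>
        N w = apply_seq N (p - 1) [1, 2, 1, 2] w \<and> N w = apply_seq N (p - 1) [2, 1, 2] w)"

end

theory Submission imports Defs begin

text \<open>For a normal word \<open>s#y\<close>, class \<open>(4,3)\<close> allows \<open>N (a#s#y)\<close> to be computed by a single pass from
  left to right: if \<open>N [a,s] = [h,t]\<close>, then \<open>N (a#s#y) = h # N (t#y)\<close>. Hence appending a letter \<open>c\<close>
  to \<open>s#y\<close> (keeping it normal) does not change the first letter \<open>h\<close> of the normal form, and
  \<open>N (a#s#y@[c]) = h # N (N (t#y) @ [c])\<close>. This is the effect of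
  $N^{[p-1]}_{12}$ on a word whose last $p-1$ letters form a normal word.\<close>

locale quadratic_normalisation_4_3 =
  fixes S :: "'a set" and N :: "'a list \<Rightarrow> 'a list"
  assumes normalisation: "normalisation S N"
    and quadratic: "quadratic S N"
    and class_4_3: "class_4_3 S N"
begin

lemma N_in_lists: "w \<in> lists S \<Longrightarrow> N w \<in> lists S"
  using normalisation by (simp add: normalisation_def)

lemma length_N: "w \<in> lists S \<Longrightarrow> length (N w) = length w"
  using normalisation by (simp add: normalisation_def)

lemma N_singleton: "a \<in> S \<Longrightarrow> N [a] = [a]"
  using normalisation by (simp add: normalisation_def)

lemma N_absorb:
  "u \<in> lists S \<Longrightarrow> w \<in> lists S \<Longrightarrow> v \<in> lists S \<Longrightarrow> N (u @ N w @ v) = N (u @ w @ v)"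
  using normalisation by (simp add: normalisation_def)

lemma N_idem: "w \<in> lists S \<Longrightarrow> N (N w) = N w"
  using N_absorb[of "[]" w "[]"] by simp

lemma N_pairE:
  assumes "a \<in> S" "b \<in> S"
  obtains h t where "N [a, b] = [h, t]" "h \<in> S" "t \<in> S"
proof -
  have "length (N [a, b]) = 2" "N [a, b] \<in> lists S"
    using assms length_N[of "[a, b]"] N_in_lists[of "[a, b]"] by auto
  then show thesis
    using that by (auto simp: numeral_2_eq_2 length_Suc_conv)
qed

lemma normal_iff:
  "w \<in> lists S \<Longrightarrow> N w = w \<longleftrightarrow> (\<forall>u x v. w = u @ x @ v \<and> length x = 2 \<longrightarrow> N x = x)"
  using quadratic by (simp add: quadratic_def normal_word_def)

text \<open>Every length-two factor of \<open>w\<close> is also one of \<open>u @ w @ v\<close>, so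
  the local criterion for normality passes to factors.\<close>

lemma normal_factor:
  assumes "N (u @ w @ v) = u @ w @ v" "u @ w @ v \<in> lists S"
  shows "N w = w"
proof -
  have "w \<in> lists S"
    using assms(2) by auto
  moreover have "N x = x" if "w = u' @ x @ v'" "length x = 2" for u' x v'
  proof -
    have "u @ w @ v = (u @ u') @ x @ (v' @ v)"
      using that(1) by simp
    then show ?thesis
      using normal_iff[OF assms(2)] assms(1) that(2) by blast
  qed
  ultimately show ?thesis
    by (subst normal_iff) auto
qed

text \<open>The length-two factors of \<open>a # b # w\<close> are \<open>[a, b]\<close> and those
  of \<open>b # w\<close>.\<close>

lemma normal_ConsI:
  assumes "N [a, b] = [a, b]" "N (b # w) = b # w" "a # b # w \<in> lists S"
  shows "N (a # b # w) = a # b # w"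
proof -
  have "N x = x" if eq: "a # b # w = u @ x @ v" and len: "length x = 2" for u x v
  proof (cases u)
    case Nil
    then have "x = [a, b]"
      using eq len by (auto simp: numeral_2_eq_2 length_Suc_conv)
    then show ?thesis
      using assms(1) by simp
  next
    case (Cons c u')
    then have "b # w = u' @ x @ v"
      using eq by simp
    moreover have "b # w \<in> lists S"
      using assms(3) by simp
    ultimately show ?thesis
      using assms(2) normal_factor[of u' x v] by simp
  qed
  then show ?thesis
    using assms(3) by (subst normal_iff) auto
qed

text \<open>As \<open>[s, b]\<close> is normal, the first move of 212 is idle and the other two
  produce \<open>[h, h', t']\<close>. By class (4,3) this is a value of \<open>N\<close>, so its
  prefix \<open>[h, h']\<close> is normal. Class (4,3) enters the argument here.\<close>

lemma domino_rule:
  assumes "a \<in> S" "s \<in> S" "b \<in> S" "N [s, b] = [s, b]" "N [a, s] = [h, t]" "N [t, b] = [h', t']"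
  shows "N [h, h'] = [h, h']"
proof -
  have w: "[a, s, b] \<in> lists S"
    using assms by simp
  have "N [a, s, b] = apply_seq N 2 [2, 1, 2] [a, s, b]"
    using class_4_3 w unfolding class_4_3_def by (metis length_Cons list.size(3) numeral_3_eq_3)
  also have "\<dots> = [h, h', t']"
    using assms by (simp add: apply_seq_def apply_at_def numeral_2_eq_2)
  finally show ?thesis
    using normal_factor[of "[]" "[h, h']" "[t']"] N_idem[OF w] N_in_lists[OF w] by simp
qed

lemma N_Cons_normal:
  assumes "a \<in> S" "s # y \<in> lists S" "N (s # y) = s # y" "N [a, s] = [h, t]"
  shows "N (a # s # y) = h # N (t # y)"
  using assms
proof (induction y arbitrary: a s h t)
  case Nil
  then have "t \<in> S"
    using N_in_lists[of "[a, s]"] by simp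
  then show ?case
    using Nil.prems(4) by (simp add: N_singleton)
next
  case (Cons b y)
  have ht: "h \<in> S" "t \<in> S"
    using Cons.prems N_in_lists[of "[a, s]"] by auto
  have S: "s \<in> S" "b \<in> S" "y \<in> lists S"
    using Cons.prems(2) by auto
  have sb: "N [s, b] = [s, b]" and bn: "N (b # y) = b # y"
    using normal_factor[of "[]" "[s, b]" y] normal_factor[of "[s]" "b # y" "[]"] Cons.prems(2,3)
    by auto
  obtain h' t' where ht': "N [t, b] = [h', t']" "h' \<in> S" "t' \<in> S"
    using N_pairE ht(2) S(2) by blast
  \<comment> \<open>The pass moves one letter to the right: \<open>t\<close> and \<open>b\<close>
    take the roles of \<open>a\<close> and \<open>s\<close>, whence the generalised
    induction.\<close>
  have step: "N (t # b # y) = h' # N (t' # y)"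
    using Cons.IH[OF ht(2) _ bn ht'(1)] S by simp
  have tby: "t # b # y \<in> lists S"
    using ht S by simp
  \<comment> \<open>Only the junction \<open>[h, h']\<close> is new; the rest is a value of
    \<open>N\<close>.\<close>
  have "N (h # h' # N (t' # y)) = h # h' # N (t' # y)"
  proof (rule normal_ConsI)
    show "N [h, h'] = [h, h']"
      using domino_rule[OF Cons.prems(1) S(1,2) sb Cons.prems(4) ht'(1)] .
    show "N (h' # N (t' # y)) = h' # N (t' # y)"
      using N_idem[OF tby] step by simp
    show "h # h' # N (t' # y) \<in> lists S"
      using ht ht' S N_in_lists[of "t' # y"] by simp
  qed
  \<comment> \<open>A normal word is its own image; absorbing \<open>N (t # b # y)\<close> and then
    \<open>N [a, s]\<close> leads back to the original word.\<close>
  then have "h # N (t # b # y) = N (h # N (t # b # y))"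
    using step by simp
  also have "\<dots> = N (h # t # b # y)"
    using N_absorb[of "[h]" "t # b # y" "[]"] ht tby by simp
  also have "\<dots> = N (a # s # b # y)"
    using N_absorb[of "[]" "[a, s]" "b # y"] Cons.prems S by simp
  finally show ?case by simp
qed

text \<open>Both \<open>y\<close> and \<open>y @ [c]\<close> are normal and begin with the same
  letter \<open>s\<close>, so the pass splits off the same \<open>h\<close> from both words.\<close>

lemma N_Cons_normal_snoc:
  assumes "a \<in> S" "y @ [c] \<in> lists S" "y \<noteq> []" "N (y @ [c]) = y @ [c]"
  obtains h z where "N (a # y) = h # z" "N (a # y @ [c]) = h # N (z @ [c])"
proof -
  obtain s x where y: "y = s # x"
    using assms(3) by (cases y) auto
  obtain h t where ht: "N [a, s] = [h, t]" "h \<in> S" "t \<in> S"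
    using N_pairE[of a s] assms y by auto
  have "N y = y"
    using normal_factor[of "[]" y "[c]"] assms by simp
  then have "N (a # y) = h # N (t # x)"
    using N_Cons_normal[of a s x h t] assms ht y by simp
  moreover have "N (a # y @ [c]) = h # N (t # x @ [c])"
    using N_Cons_normal[of a s "x @ [c]" h t] assms ht y by simp
  moreover have "N (t # x @ [c]) = N (N (t # x) @ [c])"
    using N_absorb[of "[]" "t # x" "[c]"] assms ht y by simp
  ultimately show thesis
    using that by simp
qed

lemma apply_at_in_lists: "w \<in> lists S \<Longrightarrow> apply_at N q i w \<in> lists S"
  unfolding apply_at_def
  using N_in_lists[of "take q (drop (i - 1) w)"]
  by (auto dest: in_set_takeD in_set_dropD)

lemma length_apply_at: "w \<in> lists S \<Longrightarrow> length (apply_at N q i w) = length w"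
proof -
  assume "w \<in> lists S"
  then have "take q (drop (i - 1) w) \<in> lists S"
    by (auto dest: in_set_takeD in_set_dropD)
  from length_N[OF this] show ?thesis
    by (simp add: apply_at_def min_def)
qed

text \<open>No range condition on \<open>i\<close> and \<open>q\<close> is needed: the three pieces
  cut by \<open>take\<close> and \<open>drop\<close> always concatenate to \<open>w\<close>.\<close>

lemma N_apply_at: "w \<in> lists S \<Longrightarrow> N (apply_at N q i w) = N w"
proof -
  assume w: "w \<in> lists S"
  let ?u = "take (i - 1) w" and ?x = "take q (drop (i - 1) w)" and ?v = "drop (i - 1 + q) w"
  have "?u @ ?x @ ?v = w"
    by (metis add.commute append_take_drop_id drop_drop)
  moreover have "?u \<in> lists S" "?x \<in> lists S" "?v \<in> lists S"
    using w by (auto dest: in_set_takeD in_set_dropD)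
  ultimately show ?thesis
    unfolding apply_at_def using N_absorb by metis
qed

lemma N_eq_apply_seq_212:
  assumes w: "w \<in> lists S" and len: "length w = p" and p: "3 \<le> p"
  shows "N w = apply_seq N (p - 1) [2, 1, 2] w"
proof -
  obtain a v where av: "w = a # v"
    using len p by (cases w) auto
  have S: "a \<in> S" "v \<in> lists S" and lv: "length v = p - 1"
    using w len av by auto
  have "length (N v) = p - 1"
    using length_N[OF S(2)] lv by simp
  then have "N v \<noteq> []"
    using p by auto
  \<comment> \<open>After the first move the word is \<open>a # y @ [c]\<close>; the move at
    position 1 then acts on \<open>a # y\<close> and leaves \<open>c\<close> alone.\<close>
  then obtain y c where yc: "N v = y @ [c]"
    by (metis rev_exhaust)
  have ly: "length y + 1 = p - 1" and ycS: "y @ [c] \<in> lists S"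
    using \<open>length (N v) = p - 1\<close> yc N_in_lists[OF S(2)] by auto
  \<comment> \<open>Here \<open>3 \<le> p\<close> matters: \<open>y\<close> has length
    \<open>p - 2\<close>.\<close>
  have "y \<noteq> []" "N (y @ [c]) = y @ [c]"
    using ly p N_idem[OF S(2)] yc by auto
  then obtain h z where hz: "N (a # y) = h # z" "N (a # y @ [c]) = h # N (z @ [c])"
    using N_Cons_normal_snoc[OF S(1) ycS] by blast
  have lz: "length z = length y"
    using length_N[of "a # y"] hz(1) S ycS by simp
  have "apply_at N (p - 1) 2 w = a # y @ [c]"
    using lv yc by (simp add: apply_at_def av)
  \<comment> \<open>Writing \<open>p - 1\<close> as \<open>length y + 1\<close> lets
    \<open>take\<close> and \<open>drop\<close> be evaluated.\<close>
  moreover have "apply_at N (p - 1) 1 (a # y @ [c]) = h # z @ [c]"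
    using hz(1) unfolding ly[symmetric] by (simp add: apply_at_def)
  moreover have "apply_at N (p - 1) 2 (h # z @ [c]) = h # N (z @ [c])"
    using lz unfolding ly[symmetric] by (simp add: apply_at_def)
  ultimately have "apply_seq N (p - 1) [2, 1, 2] w = N (a # y @ [c])"
    using hz(2) by (simp add: apply_seq_def)
  also have "\<dots> = N w"
    using N_absorb[of "[a]" v "[]"] S by (simp add: av yc)
  finally show ?thesis by simp
qed

text \<open>The sequence 1212 is 212 preceded by a move at position 1, which preserves the value of
  \<open>N\<close>, the length and the alphabet.\<close>

lemma p_class_4_3: "3 \<le> p \<Longrightarrow> p_class_4_3 p S N"
  unfolding p_class_4_3_def
proof (intro ballI impI conjI)
  fix w assume p: "3 \<le> p" and w: "w \<in> lists S" "length w = p"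
  show "N w = apply_seq N (p - 1) [2, 1, 2] w"
    by (rule N_eq_apply_seq_212[OF w p])
  have "N w = N (apply_at N (p - 1) 1 w)"
    using N_apply_at[OF w(1)] by simp
  also have "\<dots> = apply_seq N (p - 1) [2, 1, 2] (apply_at N (p - 1) 1 w)"
    using N_eq_apply_seq_212[OF apply_at_in_lists[OF w(1)] _ p] length_apply_at[OF w(1)] w(2)
    by simp
  also have "\<dots> = apply_seq N (p - 1) [1, 2, 1, 2] w"
    by (simp add: apply_seq_def)
  finally show "N w = apply_seq N (p - 1) [1, 2, 1, 2] w" .
qed

end

theorem corollary4p2p10:
  fixes S :: "'a set" and N :: "'a list \<Rightarrow> 'a list"
  assumes "normalisation S N"
    and "quadratic S N"
    and "class_4_3 S N"
  shows "\<forall>p\<ge>3. p_class_4_3 p S N"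
  using quadratic_normalisation_4_3.p_class_4_3[OF quadratic_normalisation_4_3.intro[OF assms]]
  by blast

end
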